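(* Let $X$ and $Y$ be metric spaces such that the metric segment $[X,Y]$ in $\mathcal{GH}$ is non-degenerate, i.e. $d_{GH}(X,Y)>0$. Suppose there is a metric space $Z\in[X,Y]$ with at least one isolated point such that $d_{GH}(X,Z)>0$ and $d_{GH}(Z,Y)>0$. Then for every cardinal $m$ there is a metric space $W(m)$ lying in $[X,Y]$ such that $W(m)$ contains a simplex with $m$ vertices, and such that, if $Z$ is compact and $m$ is finite, then $W(m)$ is compact.
   Context: All metric spaces are non-empty and have finite-valued metrics (they need be neither bounded nor compact). The Gromov--Hausdorff distance $d_{GH}(X,Y)\in[0,\infty]$ between metric spaces $X,Y$ is the infimum of those $r$ for which there exist a metric space $W$ and subsets $X',Y'\subset W$ isometric to $X$ and $Y$ respectively with Hausdorff distance $d_H(X',Y')\le r$, where $d_H(A,B)=\max\{\sup_{a\in A}\inf_{b\in B}|ab|,\ \sup_{b\in B}\inf_{a\in A}|ab|\}$. Note that $d_{GH}$ may be infinite, and may vanish on non-isometric spaces. $\mathcal{GH}$ denotes the proper class (in the sense of von Neumann--Bernays--Gödel set theory) of all metric spaces considered up to isometry, endowed with $d_{GH}$. For $X,Y\in\mathcal{GH}$ the metric segment is $[X,Y]=\{Z\in\mathcal{GH}: d_{GH}(X,Z)+d_{GH}(Z,Y)=d_{GH}(X,Y)\}$ (an equality in $[0,\infty]$). A simplex with $m$ vertices is a metric space of cardinality $m$ all of whose non-zero distances are equal to one and the same number $\lambda>0$; "$W$ contains a simplex with $m$ vertices" means that some subset of $W$ with the induced metric is such a simplex. *)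

theory Defs
  imports "HOL-Analysis.Analysis" "HOL-Library.Equipollence"
begin

text \<open>
  Metric spaces are values of the library type \<open>'a metric\<close> (a carrier \<open>mspace X\<close> with a
  real-valued distance \<open>mdist X\<close>). The library allows an empty carrier, so non-emptiness is
  assumed explicitly where spaces are quantified.
\<close>

definition isometric :: "'a metric \<Rightarrow> 'b metric \<Rightarrow> bool" where
  "isometric X Y \<longleftrightarrow>
     (\<exists>f. bij_betw f (mspace X) (mspace Y) \<and>
          (\<forall>x\<in>mspace X. \<forall>x'\<in>mspace X. mdist Y (f x) (f x') = mdist X x x'))"

definition hausdorff_dist :: "'w metric \<Rightarrow> 'w set \<Rightarrow> 'w set \<Rightarrow> ennreal" where
  "hausdorff_dist W A B =
     max (SUP a\<in>A. INF b\<in>B. ennreal (mdist W a b)) (SUP b\<in>B. INF a\<in>A. ennreal (mdist W a b))"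

definition gh_realised :: "'a metric \<Rightarrow> 'b metric \<Rightarrow> 'w metric \<Rightarrow> ennreal \<Rightarrow> bool" where
  "gh_realised X Y W r \<longleftrightarrow>
     (\<exists>X' Y'. X' \<subseteq> mspace W \<and> Y' \<subseteq> mspace W \<and>
        isometric X (submetric W X') \<and> isometric Y (submetric W Y') \<and>
        hausdorff_dist W X' Y' \<le> r)"

text \<open>
  The ambient space \<open>W\<close> in the Gromov--Hausdorff distance ranges over metric spaces whose points
  are taken from \<open>'a + 'b\<close>. This is no restriction: only \<open>X' \<union> Y'\<close> matters, and it injects into
  \<open>'a + 'b\<close>. Lemma \<open>gh_dist_le\<close> below shows that ambient spaces over any other type
  do not lower the infimum.
\<close>

definition gh_dist :: "'a metric \<Rightarrow> 'b metric \<Rightarrow> ennreal" where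
  "gh_dist X Y = Inf {r. \<exists>W :: ('a + 'b) metric. gh_realised X Y W r}"

definition metric_segment :: "'a metric \<Rightarrow> 'b metric \<Rightarrow> 'c metric set" where
  "metric_segment X Y = {Z. mspace Z \<noteq> {} \<and> gh_dist X Z + gh_dist Z Y = gh_dist X Y}"

text \<open>
  A cardinal is given by a set \<open>M\<close> having that cardinality. For the cardinal zero (\<open>M = {}\<close>)
  this admits the empty simplex.
\<close>

definition simplex_of_card :: "'a metric \<Rightarrow> 'd set \<Rightarrow> bool" where
  "simplex_of_card S M \<longleftrightarrow>
     mspace S \<approx> M \<and>
     (\<exists>l>0. \<forall>x\<in>mspace S. \<forall>y\<in>mspace S. mdist S x y \<noteq> 0 \<longrightarrow> mdist S x y = l)"

definition contains_simplex :: "'a metric \<Rightarrow> 'd set \<Rightarrow> bool" where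
  "contains_simplex W M \<longleftrightarrow> (\<exists>S\<subseteq>mspace W. simplex_of_card (submetric W S) M)"

lemma hausdorff_dist_image:
  assumes "\<And>u v. u \<in> A \<union> B \<Longrightarrow> v \<in> A \<union> B \<Longrightarrow> mdist V (h u) (h v) = mdist W u v"
  shows "hausdorff_dist V (h ` A) (h ` B) = hausdorff_dist W A B"
  unfolding hausdorff_dist_def image_image
  by (intro arg_cong2[where f = max] SUP_cong INF_cong refl) (simp_all add: assms)

lemma isometric_trans:
  assumes "isometric X Y" "isometric Y Z"
  shows "isometric X Z"
proof -
  obtain f where f: "bij_betw f (mspace X) (mspace Y)"
    "\<forall>x\<in>mspace X. \<forall>x'\<in>mspace X. mdist Y (f x) (f x') = mdist X x x'"
    using assms(1) unfolding isometric_def by blast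
  obtain g where g: "bij_betw g (mspace Y) (mspace Z)"
    "\<forall>x\<in>mspace Y. \<forall>x'\<in>mspace Y. mdist Z (g x) (g x') = mdist Y x x'"
    using assms(2) unfolding isometric_def by blast
  show ?thesis unfolding isometric_def
  proof (intro exI conjI ballI)
    show "bij_betw (g \<circ> f) (mspace X) (mspace Z)"
      using f(1) g(1) by (rule bij_betw_trans)
    fix x x' assume "x \<in> mspace X" "x' \<in> mspace X"
    then show "mdist Z ((g \<circ> f) x) ((g \<circ> f) x') = mdist X x x'"
      using f g by (simp add: bij_betwE)
  qed
qed

lemma gh_dist_le:
  fixes X :: "'a metric" and Y :: "'b metric" and W :: "'w metric"
  assumes "gh_realised X Y W r"
  shows "gh_dist X Y \<le> r"
proof -
  obtain X' Y' where sub: "X' \<subseteq> mspace W" "Y' \<subseteq> mspace W"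
    and iso: "isometric X (submetric W X')" "isometric Y (submetric W Y')"
    and r: "hausdorff_dist W X' Y' \<le> r"
    using assms unfolding gh_realised_def by blast
  obtain f where f: "bij_betw f (mspace X) X'"
    using iso(1) sub(1) unfolding isometric_def by (auto simp: Int_absorb2)
  obtain g where g: "bij_betw g (mspace Y) Y'"
    using iso(2) sub(2) unfolding isometric_def by (auto simp: Int_absorb2)
  define U where "U = X' \<union> Y'"
  define h :: "'w \<Rightarrow> 'a + 'b" where
    "h = (\<lambda>u. if u \<in> X' then Inl (inv_into (mspace X) f u) else Inr (inv_into (mspace Y) g u))"
  have inj: "inj_on h U"
  proof (rule inj_onI)
    fix u v assume u: "u \<in> U" and v: "v \<in> U" and eq: "h u = h v"
    have f_inv: "f (inv_into (mspace X) f w) = w" if "w \<in> X'" for w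
      using bij_betw_inv_into_right[OF f that] .
    have g_inv: "g (inv_into (mspace Y) g w) = w" if "w \<in> Y'" for w
      using bij_betw_inv_into_right[OF g that] .
    show "u = v"
    proof (cases "u \<in> X'")
      case True
      then have "v \<in> X'" using eq by (simp add: h_def split: if_splits)
      with True eq have "inv_into (mspace X) f u = inv_into (mspace X) f v" by (simp add: h_def)
      then show ?thesis using f_inv[OF True] f_inv[OF \<open>v \<in> X'\<close>] by metis
    next
      case False
      then have nv: "v \<notin> X'" using eq by (auto simp: h_def)
      with False eq have eq': "inv_into (mspace Y) g u = inv_into (mspace Y) g v" by (simp add: h_def)
      have "u \<in> Y'" "v \<in> Y'" using u v False nv by (auto simp: U_def)
      then show ?thesis using g_inv[of u] g_inv[of v] eq' by metis
    qed
  qed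
  define k where "k = inv_into U h"
  have kh: "k (h u) = u" if "u \<in> U" for u
    using inj that by (simp add: k_def)
  have UW: "U \<subseteq> mspace W" using sub by (auto simp: U_def)
  have "Metric_space (h ` U) (\<lambda>p q. mdist W (k p) (k q))"
  proof
    fix x y assume "x \<in> h ` U" "y \<in> h ` U"
    then show "(mdist W (k x) (k y) = 0) = (x = y)"
      using UW kh by (auto simp: kh subset_iff)
  next
    fix x y z assume "x \<in> h ` U" "y \<in> h ` U" "z \<in> h ` U"
    then show "mdist W (k x) (k z) \<le> mdist W (k x) (k y) + mdist W (k y) (k z)"
      using UW kh by (auto simp: kh subset_iff intro!: mdist_triangle)
  qed (simp_all add: mdist_commute)
  then interpret V: Metric_space "h ` U" "\<lambda>p q. mdist W (k p) (k q)" .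
  define V where "V = metric (h ` U, \<lambda>p q. mdist W (k p) (k q))"
  have V: "mspace V = h ` U" "mdist V (h u) (h v) = mdist W u v" if "u \<in> U" "v \<in> U" for u v
    using that by (simp_all add: V_def kh)
  have mV: "mspace V = h ` U" by (simp add: V_def)
  have transfer: "isometric (submetric W A) (submetric V (h ` A))" if A: "A \<subseteq> U" for A
    unfolding isometric_def
  proof (intro exI conjI ballI)
    show "bij_betw h (mspace (submetric W A)) (mspace (submetric V (h ` A)))"
      using A UW mV inj by (auto simp: bij_betw_def intro: inj_on_subset)
    fix x x' assume "x \<in> mspace (submetric W A)" "x' \<in> mspace (submetric W A)"
    then show "mdist (submetric V (h ` A)) (h x) (h x') = mdist (submetric W A) x x'"
      using A V(2) by auto
  qed
  have "gh_realised X Y V r"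
    unfolding gh_realised_def
  proof (intro exI conjI)
    show "h ` X' \<subseteq> mspace V" "h ` Y' \<subseteq> mspace V" by (auto simp: mV U_def)
    show "isometric X (submetric V (h ` X'))"
      using iso(1) transfer[of X'] isometric_trans by (auto simp: U_def)
    show "isometric Y (submetric V (h ` Y'))"
      using iso(2) transfer[of Y'] isometric_trans by (auto simp: U_def)
    show "hausdorff_dist V (h ` X') (h ` Y') \<le> r"
      using r V(2) by (subst hausdorff_dist_image[where W = W]) (auto simp: U_def)
  qed
  then show ?thesis
    unfolding gh_dist_def by (intro Inf_lower) auto
qed

end

theory Submission
  imports Defs
begin

text \<open>
  The space \<open>W\<close> is \<open>Z\<close> with its isolated point \<open>z\<close> replaced by a tiny regular simplex: one extra
  point for each element of \<open>M\<close>, all of them at distance \<open>l\<close> from \<open>z\<close> and from each other, and as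
  far from the rest of \<open>Z\<close> as \<open>z\<close> is. Because \<open>z\<close> is isolated, this satisfies the triangle
  inequality for small \<open>l\<close> (\<open>mspace_blow_up\<close>, \<open>mdist_blow_up\<close>), and adding finitely many points
  preserves compactness.

  What has to be seen is that \<open>W\<close> is no farther from \<open>X\<close> than \<open>Z\<close> is, and likewise for \<open>Y\<close>. Up to a
  factor of two, the Gromov--Hausdorff distance is the least distortion of a correspondence, that is,
  of a relation between the two spaces that is total on both sides
  (\<open>gh_dist_less_imp_correspondence\<close>, \<open>correspondence_imp_gh_dist_le\<close>). Take a correspondence between
  \<open>X\<close> and \<open>Z\<close> and let whatever is related to \<open>z\<close> be related to the whole simplex. The only distances
  that change are those inside the simplex, from \<open>0\<close> to \<open>l\<close>. They are compared with distances
  \<open>|xx'|\<close> between points related to \<open>z\<close>, which the distortion already bounds; so both numbers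
  lie between \<open>0\<close> and the distortion as soon as \<open>l \<le> 2 * gh_dist X Z\<close>, and the distortion does not
  grow (\<open>gh_dist_expansion_le\<close>). This is where \<open>gh_dist X Z > 0\<close> and \<open>gh_dist Z Y > 0\<close> enter.
  Hence \<open>gh_dist X W + gh_dist W Y \<le> gh_dist X Y\<close>, and the triangle inequality turns this into an
  equality; infinite distances need no separate treatment.
\<close>

section \<open>Correspondences and the Gromov--Hausdorff distance\<close>

text \<open>
  A correspondence carries a bound \<open>t\<close> on its distortion rather than the distortion itself, which is a
  supremum and may be infinite.
\<close>

definition correspondence :: "'a metric \<Rightarrow> 'b metric \<Rightarrow> real \<Rightarrow> ('a \<times> 'b) set \<Rightarrow> bool" where
  "correspondence X Y t R \<longleftrightarrow>
     fst ` R = mspace X \<and> snd ` R = mspace Y \<and>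
     (\<forall>(x, y)\<in>R. \<forall>(x', y')\<in>R. \<bar>mdist X x x' - mdist Y y y'\<bar> \<le> t)"

lemma mdist_self: "x \<in> mspace X \<Longrightarrow> mdist X x x = 0"
  by simp

lemma gh_dist_commute: "gh_dist X Y = gh_dist Y X"
proof -
  have *: "gh_dist X Y \<le> gh_dist Y X" for X :: "'p metric" and Y :: "'q metric"
    unfolding gh_dist_def[of Y X]
  proof (rule Inf_greatest)
    fix r assume "r \<in> {r. \<exists>W :: ('q + 'p) metric. gh_realised Y X W r}"
    then obtain W :: "('q + 'p) metric" where "gh_realised Y X W r" by blast
    moreover have "hausdorff_dist W A B = hausdorff_dist W B A" for A B
      unfolding hausdorff_dist_def by (subst max.commute) (simp add: mdist_commute)
    ultimately have "gh_realised X Y W r"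
      unfolding gh_realised_def by metis
    then show "gh_dist X Y \<le> r" by (rule gh_dist_le)
  qed
  show ?thesis by (intro antisym *)
qed

text \<open>
  In an ambient space where the two copies are Hausdorff-closer than \<open>r\<close>, relating the points at
  distance less than \<open>r\<close> reaches every point, and moving both ends of a segment by less than \<open>r\<close>
  changes its length by less than \<open>2 * r\<close>.
\<close>

lemma gh_dist_less_imp_correspondence:
  assumes "gh_dist X Y < ennreal r"
  shows "\<exists>R. correspondence X Y (2 * r) R"
proof -
  obtain W :: "('a + 'b) metric" and q where q: "q < ennreal r" and W: "gh_realised X Y W q"
    using assms unfolding gh_dist_def Inf_less_iff by blast
  obtain X' Y' where sub: "X' \<subseteq> mspace W" "Y' \<subseteq> mspace W"
    and iso: "isometric X (submetric W X')" "isometric Y (submetric W Y')"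
    and h: "hausdorff_dist W X' Y' \<le> q"
    using W unfolding gh_realised_def by blast
  obtain f where f: "bij_betw f (mspace X) X'"
    and fd: "\<And>x x'. x \<in> mspace X \<Longrightarrow> x' \<in> mspace X \<Longrightarrow> mdist W (f x) (f x') = mdist X x x'"
    using iso(1) sub(1) unfolding isometric_def by (auto simp: Int_absorb2)
  obtain g where g: "bij_betw g (mspace Y) Y'"
    and gd: "\<And>y y'. y \<in> mspace Y \<Longrightarrow> y' \<in> mspace Y \<Longrightarrow> mdist W (g y) (g y') = mdist Y y y'"
    using iso(2) sub(2) unfolding isometric_def by (auto simp: Int_absorb2)
  have fW: "f x \<in> mspace W" if "x \<in> mspace X" for x
    using f sub that by (auto dest: bij_betwE)
  have gW: "g y \<in> mspace W" if "y \<in> mspace Y" for y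
    using g sub that by (auto dest: bij_betwE)
  define R where "R = {(x, y). x \<in> mspace X \<and> y \<in> mspace Y \<and> mdist W (f x) (g y) < r}"
  have "\<exists>y. (x, y) \<in> R" if x: "x \<in> mspace X" for x
  proof -
    have "(INF b\<in>Y'. ennreal (mdist W (f x) b)) \<le> (SUP a\<in>X'. INF b\<in>Y'. ennreal (mdist W a b))"
      using f x by (intro SUP_upper) (auto dest: bij_betwE)
    also have "\<dots> < ennreal r"
      using h q by (auto simp: hausdorff_dist_def)
    finally obtain b where b: "b \<in> Y'" "ennreal (mdist W (f x) b) < ennreal r"
      unfolding INF_less_iff by blast
    obtain y where "y \<in> mspace Y" "b = g y" using b(1) g by (auto simp: bij_betw_def)
    then show ?thesis using x b(2) by (auto simp: R_def ennreal_less_iff)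
  qed
  moreover have "\<exists>x. (x, y) \<in> R" if y: "y \<in> mspace Y" for y
  proof -
    have "(INF a\<in>X'. ennreal (mdist W a (g y))) \<le> (SUP b\<in>Y'. INF a\<in>X'. ennreal (mdist W a b))"
      using g y by (intro SUP_upper) (auto dest: bij_betwE)
    also have "\<dots> < ennreal r"
      using h q by (auto simp: hausdorff_dist_def)
    finally obtain a where a: "a \<in> X'" "ennreal (mdist W a (g y)) < ennreal r"
      unfolding INF_less_iff by blast
    obtain x where "x \<in> mspace X" "a = f x" using a(1) f by (auto simp: bij_betw_def)
    then show ?thesis using y a(2) by (auto simp: R_def ennreal_less_iff)
  qed
  moreover have "\<bar>mdist X x x' - mdist Y y y'\<bar> \<le> 2 * r" if "(x, y) \<in> R" "(x', y') \<in> R" for x y x' y'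
  proof -
    have m: "x \<in> mspace X" "x' \<in> mspace X" "y \<in> mspace Y" "y' \<in> mspace Y"
      "mdist W (f x) (g y) < r" "mdist W (f x') (g y') < r"
      using that by (auto simp: R_def)
    note T = mdist_triangle[where m = W]
    have "mdist W (f x) (f x') \<le> mdist W (f x) (g y) + mdist W (g y) (g y') + mdist W (g y') (f x')"
      using T[of "f x" "g y" "f x'"] T[of "g y" "g y'" "f x'"] m fW gW by force
    moreover
    have "mdist W (g y) (g y') \<le> mdist W (g y) (f x) + mdist W (f x) (f x') + mdist W (f x') (g y')"
      using T[of "g y" "f x" "g y'"] T[of "f x" "f x'" "g y'"] m fW gW by force
    ultimately show ?thesis
      using m by (simp add: fd gd mdist_commute[of W "g y" "f x"] mdist_commute[of W "g y'" "f x'"])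
  qed
  ultimately have "correspondence X Y (2 * r) R"
    unfolding correspondence_def by (force simp: R_def image_iff)
  then show ?thesis ..
qed

text \<open>
  The converse glues \<open>X\<close> and \<open>Y\<close> along \<open>R\<close>, with a bridge of length \<open>r\<close> between any two related
  points. The distance across is the length of the shortest path over one bridge; a path that crosses
  over and back is no shortcut, since what it saves is at most the distortion \<open>2 * r\<close>, the length of
  its two bridges. Positivity of \<open>r\<close> keeps the copies disjoint.
\<close>

lemma correspondence_imp_gh_dist_le:
  fixes X :: "'a metric" and Y :: "'b metric"
  assumes X: "mspace X \<noteq> {}" and R: "correspondence X Y (2 * r) R" and r: "r > 0"
  shows "gh_dist X Y \<le> ennreal r"
proof -
  define E where "E x y = (\<lambda>(a, b). mdist X x a + r + mdist Y b y)" for x y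
  define c where "c x y = (INF p\<in>R. E x y p)" for x y
  define U where "U = Inl ` mspace X \<union> Inr ` mspace Y"
  define D :: "'a + 'b \<Rightarrow> 'a + 'b \<Rightarrow> real" where
    "D u v = (case u of
        Inl x \<Rightarrow> (case v of Inl x' \<Rightarrow> mdist X x x' | Inr y \<Rightarrow> c x y)
      | Inr y \<Rightarrow> (case v of Inl x \<Rightarrow> c x y | Inr y' \<Rightarrow> mdist Y y y'))" for u v
  have D: "D (Inl x) (Inl x') = mdist X x x'" "D (Inl x) (Inr y) = c x y"
    "D (Inr y) (Inl x) = c x y" "D (Inr y) (Inr y') = mdist Y y y'" for x x' y y'
    by (simp_all add: D_def)
  have RX: "a \<in> mspace X" and RY: "b \<in> mspace Y" if "(a, b) \<in> R" for a b
    using R that by (force simp: correspondence_def)+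
  have dis: "mdist X a a' \<le> mdist Y b b' + 2 * r" "mdist Y b b' \<le> mdist X a a' + 2 * r"
    if "(a, b) \<in> R" "(a', b') \<in> R" for a b a' b'
    using R that unfolding correspondence_def by force+
  \<comment> \<open>An infimum over the empty set of reals has no useful value, so \<open>c\<close> needs a bridge to exist.\<close>
  have ne: "R \<noteq> {}"
    using R X by (auto simp: correspondence_def)
  have E_ge: "r \<le> E x y p" for x y p
    by (simp add: E_def split: prod.split)
  have c_le: "c x y \<le> mdist X x a + r + mdist Y b y" if "(a, b) \<in> R" for x y a b
    using cINF_lower[of "E x y" R "(a, b)"] that E_ge unfolding c_def
    by (force simp: E_def intro!: bdd_belowI2[where m = r])
  have c_ge: "t \<le> c x y" if "\<And>a b. (a, b) \<in> R \<Longrightarrow> t \<le> mdist X x a + r + mdist Y b y"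
    for t x y
    unfolding c_def using that ne by (intro cINF_greatest) (auto simp: E_def)
  have c_pos: "r \<le> c x y" for x y
    by (rule c_ge) simp
  have TX: "mdist X u w \<le> mdist X u v + mdist X v w" if "{u, v, w} \<subseteq> mspace X" for u v w
    using that by (simp add: mdist_triangle)
  have TY: "mdist Y u w \<le> mdist Y u v + mdist Y v w" if "{u, v, w} \<subseteq> mspace Y" for u v w
    using that by (simp add: mdist_triangle)
  have t1: "c x y \<le> mdist X x x' + c x' y" if "x \<in> mspace X" "x' \<in> mspace X" for x x' y
  proof -
    have "c x y - mdist X x x' \<le> c x' y"
    proof (rule c_ge)
      fix a b assume ab: "(a, b) \<in> R"
      show "c x y - mdist X x x' \<le> mdist X x' a + r + mdist Y b y"
        using c_le[OF ab, of x y] TX[of x x' a] that RX[OF ab] by simp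
    qed
    then show ?thesis by simp
  qed
  have t2: "c x y \<le> c x y' + mdist Y y' y" if "x \<in> mspace X" "y \<in> mspace Y" "y' \<in> mspace Y" for x y y'
  proof -
    have "c x y - mdist Y y' y \<le> c x y'"
    proof (rule c_ge)
      fix a b assume ab: "(a, b) \<in> R"
      show "c x y - mdist Y y' y \<le> mdist X x a + r + mdist Y b y'"
        using c_le[OF ab, of x y] TY[of b y' y] that RY[OF ab] by simp
    qed
    then show ?thesis by simp
  qed
  have t1': "c x y \<le> c x' y + mdist X x' x" if "x \<in> mspace X" "x' \<in> mspace X" for x x' y
    using t1[OF that, of y] by (simp add: add.commute mdist_commute[of X x'])
  have t2': "c x y \<le> mdist Y y y' + c x y'" if "x \<in> mspace X" "y \<in> mspace Y" "y' \<in> mspace Y" for x y y'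
    using t2[OF that] by (simp add: add.commute mdist_commute[of Y y'])
  \<comment> \<open>The two round trips: here the distortion bound is used.\<close>
  have t3: "mdist X x x' \<le> c x y + c x' y"
    if "x \<in> mspace X" "x' \<in> mspace X" "y \<in> mspace Y" for x x' y
  proof -
    have "mdist X x x' - c x' y \<le> c x y"
    proof (rule c_ge)
      fix a b assume ab: "(a, b) \<in> R"
      have "mdist X x x' - (mdist X x a + r + mdist Y b y) \<le> c x' y"
      proof (rule c_ge)
        fix a' b' assume ab': "(a', b') \<in> R"
        show "mdist X x x' - (mdist X x a + r + mdist Y b y) \<le> mdist X x' a' + r + mdist Y b' y"
          using TX[of x a x'] TX[of a a' x'] dis(1)[OF ab ab'] TY[of b y b'] that
            RX[OF ab] RX[OF ab'] RY[OF ab] RY[OF ab']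
            mdist_commute[of X a' x'] mdist_commute[of Y b' y] by simp
      qed
      then show "mdist X x x' - c x' y \<le> mdist X x a + r + mdist Y b y" by simp
    qed
    then show ?thesis by simp
  qed
  have t4: "mdist Y y y' \<le> c x y + c x y'"
    if "x \<in> mspace X" "y \<in> mspace Y" "y' \<in> mspace Y" for x y y'
  proof -
    have "mdist Y y y' - c x y' \<le> c x y"
    proof (rule c_ge)
      fix a b assume ab: "(a, b) \<in> R"
      have "mdist Y y y' - (mdist X x a + r + mdist Y b y) \<le> c x y'"
      proof (rule c_ge)
        fix a' b' assume ab': "(a', b') \<in> R"
        show "mdist Y y y' - (mdist X x a + r + mdist Y b y) \<le> mdist X x a' + r + mdist Y b' y'"
          using TY[of y b y'] TY[of b b' y'] dis(2)[OF ab ab'] TX[of a x a'] that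
            RX[OF ab] RX[OF ab'] RY[OF ab] RY[OF ab']
            mdist_commute[of X a x] mdist_commute[of Y b y] by simp
      qed
      then show "mdist Y y y' - c x y' \<le> mdist X x a + r + mdist Y b y" by simp
    qed
    then show ?thesis by simp
  qed
  have "0 < c x y" for x y
    using c_pos[of x y] r by simp
  then have c0: "0 \<le> c x y" "c x y \<noteq> 0" for x y
    by (simp_all add: less_imp_le less_imp_neq[symmetric])
  interpret V: Metric_space U D
  proof
    show "0 \<le> D u v" "D u v = D v u" for u v
      by (cases u; cases v; simp add: D c0 mdist_commute)+
    show "(D u v = 0) = (u = v)" if "u \<in> U" "v \<in> U" for u v
      using that by (auto simp: U_def D c0)
    show "D u w \<le> D u v + D v w" if "u \<in> U" "v \<in> U" "w \<in> U" for u v w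
      using that unfolding U_def
      by (elim UnE imageE; hypsubst; unfold D; intro TX TY t1 t1' t2 t2' t3 t4; simp)
  qed
  define V where "V = metric (U, D)"
  have V: "mspace V = U" "mdist V = D"
    by (simp_all add: V_def)
  have c_le_r: "c x y \<le> r" if "(x, y) \<in> R" for x y
    using c_le[OF that, of x y] RX[OF that] RY[OF that] by (simp add: mdist_self)
  have "gh_realised X Y V (ennreal r)"
    unfolding gh_realised_def
  proof (intro exI conjI)
    show "Inl ` mspace X \<subseteq> mspace V" "Inr ` mspace Y \<subseteq> mspace V"
      by (auto simp: V U_def)
    show "isometric X (submetric V (Inl ` mspace X))"
      unfolding isometric_def
      by (rule exI[of _ Inl]) (auto simp: V U_def D bij_betw_def)
    show "isometric Y (submetric V (Inr ` mspace Y))"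
      unfolding isometric_def
      by (rule exI[of _ Inr]) (auto simp: V U_def D bij_betw_def)
    have "\<exists>y\<in>mspace Y. c x y \<le> r" if "x \<in> mspace X" for x
    proof -
      have "x \<in> fst ` R" using R that by (simp add: correspondence_def)
      then show ?thesis using c_le_r RY by force
    qed
    moreover have "\<exists>x\<in>mspace X. c x y \<le> r" if "y \<in> mspace Y" for y
    proof -
      have "y \<in> snd ` R" using R that by (simp add: correspondence_def)
      then show ?thesis using c_le_r RX by force
    qed
    ultimately show "hausdorff_dist V (Inl ` mspace X) (Inr ` mspace Y) \<le> ennreal r"
      unfolding hausdorff_dist_def image_image V D
      by (intro max.boundedI SUP_least) (meson INF_lower2 ennreal_leI)+
  qed
  then show ?thesis by (rule gh_dist_le)
qed

text \<open>Distortions add up under composition of correspondences.\<close>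

lemma gh_dist_triangle:
  assumes "mspace X \<noteq> {}"
  shows "gh_dist X Y \<le> gh_dist X Z + gh_dist Z Y"
proof (rule ennreal_le_epsilon)
  fix e :: real assume fin: "gh_dist X Z + gh_dist Z Y < top" and e: "0 < e"
  obtain a b where a: "0 \<le> a" "gh_dist X Z = ennreal a" and b: "0 \<le> b" "gh_dist Z Y = ennreal b"
    using fin less_top_ennreal[of "gh_dist X Z"] less_top_ennreal[of "gh_dist Z Y"]
    by (auto simp: ennreal_add_less_top)
  obtain R where R: "correspondence X Z (2 * (a + e / 2)) R"
    using gh_dist_less_imp_correspondence[of X Z "a + e / 2"] a e by (auto simp: ennreal_less_iff)
  obtain S where S: "correspondence Z Y (2 * (b + e / 2)) S"
    using gh_dist_less_imp_correspondence[of Z Y "b + e / 2"] b e by (auto simp: ennreal_less_iff)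
  have "correspondence X Y (2 * (a + b + e)) (R O S)"
  proof -
    have Z: "snd ` R = fst ` S"
      using R S by (simp add: correspondence_def)
    have "fst ` (R O S) = fst ` R"
    proof -
      have "\<exists>y. (x, y) \<in> R O S" if xz: "(x, z) \<in> R" for x z
      proof -
        have "z \<in> fst ` S" using xz Z by force
        then show ?thesis using xz by force
      qed
      then show ?thesis by force
    qed
    moreover have "snd ` (R O S) = snd ` S"
    proof -
      have "\<exists>x. (x, y) \<in> R O S" if zy: "(z, y) \<in> S" for z y
      proof -
        have "z \<in> snd ` R" using zy Z by force
        then show ?thesis using zy by force
      qed
      then show ?thesis by force
    qed
    ultimately have "fst ` (R O S) = mspace X" "snd ` (R O S) = mspace Y"
      using R S by (simp_all add: correspondence_def)
    moreover have "\<bar>mdist X x x' - mdist Y y y'\<bar> \<le> 2 * (a + b + e)"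
      if "(x, z) \<in> R" "(z, y) \<in> S" "(x', z') \<in> R" "(z', y') \<in> S" for x x' y y' z z'
    proof -
      have "\<bar>mdist X x x' - mdist Z z z'\<bar> \<le> 2 * (a + e / 2)"
        using R that unfolding correspondence_def by fast
      moreover have "\<bar>mdist Z z z' - mdist Y y y'\<bar> \<le> 2 * (b + e / 2)"
        using S that unfolding correspondence_def by fast
      ultimately show ?thesis by argo
    qed
    ultimately show ?thesis unfolding correspondence_def by blast
  qed
  then have "gh_dist X Y \<le> ennreal (a + b + e)"
    using assms a b e by (intro correspondence_imp_gh_dist_le) auto
  then show "gh_dist X Y \<le> gh_dist X Z + gh_dist Z Y + ennreal e"
    using a b e by simp
qed

section \<open>Expanding points into small sets\<close>

text \<open>
  If \<open>W\<close> arises from \<open>Z\<close> by expanding points into sets of diameter at most \<open>2 * gh_dist X Z\<close>, then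
  every correspondence between \<open>X\<close> and \<open>Z\<close> pulls back along \<open>p\<close> without an increase of its bound on
  the distortion: inside a fibre of \<open>p\<close>, both distances compared lie between \<open>0\<close> and that bound.
\<close>

lemma gh_dist_expansion_le:
  assumes X: "mspace X \<noteq> {}"
    and onto: "p ` mspace W = mspace Z"
    and dist: "\<And>w w'. w \<in> mspace W \<Longrightarrow> w' \<in> mspace W \<Longrightarrow>
      mdist W w w' = mdist Z (p w) (p w') \<or> p w = p w' \<and> mdist W w w' \<le> l"
    and l: "ennreal l \<le> 2 * gh_dist X Z"
  shows "gh_dist X W \<le> gh_dist X Z"
proof (rule ennreal_le_epsilon)
  fix e :: real assume fin: "gh_dist X Z < top" and e: "0 < e"
  obtain a where a: "0 \<le> a" "gh_dist X Z = ennreal a"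
    using fin unfolding less_top_ennreal by blast
  have la: "l \<le> 2 * a"
  proof -
    have "ennreal l \<le> ennreal (2 * a)"
      using l a by (simp add: ennreal_mult)
    then show ?thesis using a by (simp add: ennreal_le_iff)
  qed
  obtain R where R: "correspondence X Z (2 * (a + e)) R"
    using gh_dist_less_imp_correspondence[of X Z "a + e"] a e by (auto simp: ennreal_less_iff)
  have RZ: "z \<in> mspace Z" if "(x, z) \<in> R" for x z
    using R that by (force simp: correspondence_def)
  define R' where "R' = {(x, w). w \<in> mspace W \<and> (x, p w) \<in> R}"
  have "correspondence X W (2 * (a + e)) R'"
  proof -
    have "fst ` R' = mspace X"
    proof -
      have "\<exists>w. (x, w) \<in> R'" if xz: "(x, z) \<in> R" for x z
      proof -
        obtain w where "w \<in> mspace W" "z = p w" using RZ[OF xz] onto by blast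
        then show ?thesis using xz by (auto simp: R'_def)
      qed
      then have "fst ` R' = fst ` R" by (force simp: R'_def)
      then show ?thesis using R by (simp add: correspondence_def)
    qed
    moreover have "snd ` R' = mspace W"
    proof -
      have "\<exists>x. (x, w) \<in> R'" if "w \<in> mspace W" for w
      proof -
        have "p w \<in> snd ` R" using R that onto by (auto simp: correspondence_def)
        then show ?thesis using that by (auto simp: R'_def)
      qed
      then show ?thesis by (force simp: R'_def)
    qed
    moreover have "\<bar>mdist X x x' - mdist W w w'\<bar> \<le> 2 * (a + e)"
      if w: "(x, w) \<in> R'" "(x', w') \<in> R'" for x x' w w'
    proof -
      have m: "w \<in> mspace W" "w' \<in> mspace W" "(x, p w) \<in> R" "(x', p w') \<in> R"
        using w by (auto simp: R'_def)
      have d: "\<bar>mdist X x x' - mdist Z (p w) (p w')\<bar> \<le> 2 * (a + e)"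
        using R m(3,4) unfolding correspondence_def by fast
      from dist[OF m(1,2)] show ?thesis
      proof
        assume "mdist W w w' = mdist Z (p w) (p w')"
        then show ?thesis using d by simp
      next
        assume c: "p w = p w' \<and> mdist W w w' \<le> l"
        then have "mdist X x x' \<le> 2 * (a + e)"
          using d RZ[OF m(4)] by (simp add: mdist_self)
        moreover have "mdist W w w' \<le> 2 * (a + e)"
          using c la e by simp
        moreover have "\<bar>s - t\<bar> \<le> k" if "0 \<le> s" "0 \<le> t" "s \<le> k" "t \<le> k" for s t k :: real
          using that by linarith
        ultimately show ?thesis by simp
      qed
    qed
    ultimately show ?thesis unfolding correspondence_def by blast
  qed
  then have "gh_dist X W \<le> ennreal (a + e)"
    using X a e by (intro correspondence_imp_gh_dist_le) auto
  then show "gh_dist X W \<le> gh_dist X Z + ennreal e"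
    using a e by simp
qed

section \<open>Blowing up an isolated point to a simplex\<close>

lemma isolated_point_imp_gap:
  assumes "z \<in> mspace Z" "openin (mtopology_of Z) {z}"
  obtains d where "d > 0" "\<And>y. y \<in> mspace Z \<Longrightarrow> y \<noteq> z \<Longrightarrow> d \<le> mdist Z z y"
proof -
  interpret Z: Metric_space "mspace Z" "mdist Z" by (rule Metric_space_mspace_mdist)
  obtain d where "d > 0" "Z.mball z d \<subseteq> {z}"
    using assms unfolding mtopology_of_def Z.openin_mtopology by blast
  show ?thesis
  proof (rule that[OF \<open>d > 0\<close>])
    fix y assume y: "y \<in> mspace Z" "y \<noteq> z"
    then have "y \<notin> Z.mball z d" using \<open>Z.mball z d \<subseteq> {z}\<close> by blast
    then show "d \<le> mdist Z z y" using y(1) assms(1) by simp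
  qed
qed

text \<open>
  The point \<open>z\<close> itself stays in the blow-up, as \<open>Inl z\<close>, and the points \<open>Inr m\<close> join it. So the
  underlying set is non-empty and projects onto \<open>Z\<close> even if \<open>M\<close> is empty, and the points
  \<open>Inr m\<close> alone form a simplex with exactly as many vertices as \<open>M\<close> has elements.
\<close>

definition collapse :: "'c \<Rightarrow> 'c + 'd \<Rightarrow> 'c" where
  "collapse z = case_sum id (\<lambda>_. z)"

definition blow_up_dist :: "'c metric \<Rightarrow> 'c \<Rightarrow> real \<Rightarrow> 'c + 'd \<Rightarrow> 'c + 'd \<Rightarrow> real" where
  "blow_up_dist Z z l u v =
     (if u = v then 0 else if collapse z u = collapse z v then l
      else mdist Z (collapse z u) (collapse z v))"

definition blow_up :: "'c metric \<Rightarrow> 'c \<Rightarrow> real \<Rightarrow> 'd set \<Rightarrow> ('c + 'd) metric" where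
  "blow_up Z z l M = metric (Inl ` mspace Z \<union> Inr ` M, blow_up_dist Z z l)"

lemma collapse_simps [simp]: "collapse z (Inl x) = x" "collapse z (Inr m) = z"
  by (simp_all add: collapse_def)

text \<open>
  Two different points of the simplex are at distance \<open>l\<close>, and a detour through a point outside it
  has length at least \<open>2 * l\<close> by the gap around \<open>z\<close>; a detour inside it is no shorter than \<open>l\<close>.
  In every other case the side to be bounded has its length in \<open>Z\<close>, and the blow-up only lengthens
  the detour.
\<close>

lemma
  assumes z: "z \<in> mspace Z" and l: "l > 0"
    and gap: "\<And>y. y \<in> mspace Z \<Longrightarrow> y \<noteq> z \<Longrightarrow> l \<le> mdist Z z y"
  shows mspace_blow_up: "mspace (blow_up Z z l M) = Inl ` mspace Z \<union> Inr ` M"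
    and mdist_blow_up: "mdist (blow_up Z z l M) = blow_up_dist Z z l"
proof -
  let ?W = "Inl ` mspace Z \<union> Inr ` M"
  have fibre: "collapse z u = z" if "collapse z u = collapse z v" "u \<noteq> v" for u v :: "'a + 'b"
    using that by (cases u; cases v; simp)
  have mem: "collapse z u \<in> mspace Z" if "u \<in> ?W" for u
    using that z by auto
  have contract: "mdist Z (collapse z u) (collapse z v) \<le> blow_up_dist Z z l u v"
    if "u \<in> ?W" "v \<in> ?W" for u v
    using l mem[OF that(1)] by (auto simp: blow_up_dist_def mdist_self)
  have "Metric_space ?W (blow_up_dist Z z l)"
  proof
    show "0 \<le> blow_up_dist Z z l u v" for u v :: "'a + 'b"
      using l by (simp add: blow_up_dist_def)
    show "blow_up_dist Z z l u v = blow_up_dist Z z l v u" for u v :: "'a + 'b"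
      by (simp add: blow_up_dist_def mdist_commute)
    show "(blow_up_dist Z z l u v = 0) = (u = v)" if "u \<in> ?W" "v \<in> ?W" for u v
      using l mem[OF that(1)] mem[OF that(2)] by (simp add: blow_up_dist_def)
    show "blow_up_dist Z z l u w \<le> blow_up_dist Z z l u v + blow_up_dist Z z l v w"
      if "u \<in> ?W" "v \<in> ?W" "w \<in> ?W" for u v w
    proof (cases "u \<noteq> w \<and> collapse z u = collapse z w")
      case True
      then have c: "collapse z u = z" "collapse z w = z"
        using fibre[of u w] by auto
      show ?thesis
      proof (cases "collapse z v = z")
        case True
        then show ?thesis
          using c l \<open>u \<noteq> w \<and> _\<close> by (simp add: blow_up_dist_def)
      next
        case False
        then have "l \<le> mdist Z z (collapse z v)"
          using gap mem[OF that(2)] by simp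
        moreover have "u \<noteq> v" "v \<noteq> w"
          using False c by auto
        ultimately show ?thesis
          using False c l mdist_nonneg[of Z "collapse z v" z]
          by (simp add: blow_up_dist_def add_increasing2)
      qed
    next
      case False
      then have "blow_up_dist Z z l u w = mdist Z (collapse z u) (collapse z w)"
        using mem[OF that(1)] by (auto simp: blow_up_dist_def)
      also have "\<dots> \<le> mdist Z (collapse z u) (collapse z v) + mdist Z (collapse z v) (collapse z w)"
        using mem that by (intro mdist_triangle) auto
      also have "\<dots> \<le> blow_up_dist Z z l u v + blow_up_dist Z z l v w"
        using contract that by (intro add_mono) auto
      finally show ?thesis .
    qed
  qed
  then show "mspace (blow_up Z z l M) = ?W" "mdist (blow_up Z z l M) = blow_up_dist Z z l"
    by (simp_all add: blow_up_def Metric_space.mspace_metric Metric_space.mdist_metric)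
qed

text \<open>The blow-up is the union of an isometric copy of \<open>Z\<close> and a finite set.\<close>

lemma compact_space_blow_up:
  assumes z: "z \<in> mspace Z" and l: "l > 0"
    and gap: "\<And>y. y \<in> mspace Z \<Longrightarrow> y \<noteq> z \<Longrightarrow> l \<le> mdist Z z y"
    and Z: "compact_space (mtopology_of Z)" and M: "finite M"
  shows "compact_space (mtopology_of (blow_up Z z l M))"
proof -
  let ?W = "blow_up Z z l M"
  note W = mspace_blow_up[OF z l gap, of M] mdist_blow_up[OF z l gap, of M]
  have "Lipschitz_continuous_map Z ?W Inl"
    unfolding Lipschitz_continuous_map_def
    by (auto simp: W blow_up_dist_def intro!: exI[of _ 1])
  then have "continuous_map (mtopology_of Z) (mtopology_of ?W) Inl"
    by (rule Lipschitz_continuous_imp_continuous_map)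
  then have "compactin (mtopology_of ?W) (Inl ` mspace Z)"
    using Z image_compactin[of "mtopology_of Z" "mspace Z"] by (simp add: compact_space_def)
  moreover have "compactin (mtopology_of ?W) (Inr ` M)"
    using M by (intro finite_imp_compactin) (auto simp: W)
  ultimately show ?thesis
    using compactin_Un unfolding compact_space_def by (fastforce simp: W)
qed

lemma contains_simplex_blow_up:
  assumes z: "z \<in> mspace Z" and l: "l > 0"
    and gap: "\<And>y. y \<in> mspace Z \<Longrightarrow> y \<noteq> z \<Longrightarrow> l \<le> mdist Z z y"
  shows "contains_simplex (blow_up Z z l M) M"
proof -
  let ?W = "blow_up Z z l M"
  note W = mspace_blow_up[OF z l gap, of M] mdist_blow_up[OF z l gap, of M]
  have S: "mspace (submetric ?W (Inr ` M)) = Inr ` M"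
    by (auto simp: W)
  have "Inr ` M \<approx> M"
    by (rule inj_on_image_eqpoll_self) simp
  then have "simplex_of_card (submetric ?W (Inr ` M)) M"
    unfolding simplex_of_card_def S
    using l by (intro conjI exI[of _ l]) (auto simp: W blow_up_dist_def)
  then show ?thesis
    unfolding contains_simplex_def by (intro exI[of _ "Inr ` M"]) (auto simp: W)
qed

section \<open>Simplices in metric segments\<close>

theorem theorem2:
  fixes X :: "'a metric" and Y :: "'b metric" and Z :: "'c metric"
  assumes "mspace X \<noteq> {}" and "mspace Y \<noteq> {}"
    and "gh_dist X Y > 0"
    and "Z \<in> metric_segment X Y"
    and "\<exists>z\<in>mspace Z. openin (mtopology_of Z) {z}"
    and "gh_dist X Z > 0" and "gh_dist Z Y > 0"
  shows "\<forall>M :: 'd set. \<exists>W :: ('c + 'd) metric.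
           W \<in> metric_segment X Y \<and>
           contains_simplex W M \<and>
           (compact_space (mtopology_of Z) \<and> finite M \<longrightarrow> compact_space (mtopology_of W))"
proof
  fix M :: "'d set"
  obtain z where z: "z \<in> mspace Z" "openin (mtopology_of Z) {z}"
    using assms(5) by blast
  obtain d where d: "d > 0" "\<And>y. y \<in> mspace Z \<Longrightarrow> y \<noteq> z \<Longrightarrow> d \<le> mdist Z z y"
    using isolated_point_imp_gap[OF z] by blast
  \<comment> \<open>The edge length \<open>l\<close> must fit into the gap around \<open>z\<close> and below both distances, which may
    be infinite.\<close>
  have "0 < min (ennreal d) (min (gh_dist X Z) (gh_dist Y Z))"
    using d(1) assms(6,7) gh_dist_commute[of Y Z] by simp
  then obtain q where q: "0 < q" "q < min (ennreal d) (min (gh_dist X Z) (gh_dist Y Z))"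
    using dense by blast
  obtain l where ql: "q = ennreal l" "0 \<le> l"
    using q(2) by (cases q) auto
  have l: "l > 0" "l \<le> d" "ennreal l \<le> gh_dist X Z" "ennreal l \<le> gh_dist Y Z"
    using q ql by (auto simp: ennreal_less_iff)
  have gap: "l \<le> mdist Z z y" if "y \<in> mspace Z" "y \<noteq> z" for y
    using d(2)[OF that] l(2) by simp
  let ?W = "blow_up Z z l M"
  note W = mspace_blow_up[OF z(1) l(1) gap, of M] mdist_blow_up[OF z(1) l(1) gap, of M]
  have onto: "collapse z ` mspace ?W = mspace Z"
    using z(1) by (auto simp: W image_Un image_image)
  have near: "mdist ?W w w' = mdist Z (collapse z w) (collapse z w') \<or>
      collapse z w = collapse z w' \<and> mdist ?W w w' \<le> l" for w w'
    using l(1) by (simp add: W blow_up_dist_def)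
  have twice: "ennreal l \<le> 2 * a" if "ennreal l \<le> a" for a
    using add_mono[OF that, of 0 a] by (simp add: mult_2)
  have "gh_dist X ?W \<le> gh_dist X Z"
    using assms(1) onto near twice[OF l(3)] by (rule gh_dist_expansion_le)
  moreover have "gh_dist ?W Y \<le> gh_dist Z Y"
    unfolding gh_dist_commute[of _ Y]
    using assms(2) onto near twice[OF l(4)] by (rule gh_dist_expansion_le)
  ultimately have "gh_dist X ?W + gh_dist ?W Y \<le> gh_dist X Y"
    using assms(4) unfolding metric_segment_def by (metis (mono_tags) add_mono mem_Collect_eq)
  then have "?W \<in> metric_segment X Y"
    using gh_dist_triangle[OF assms(1), of Y ?W] z(1) by (auto simp: metric_segment_def W)
  then show "\<exists>W :: ('c + 'd) metric. W \<in> metric_segment X Y \<and> contains_simplex W M \<and>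
      (compact_space (mtopology_of Z) \<and> finite M \<longrightarrow> compact_space (mtopology_of W))"
    using contains_simplex_blow_up[OF z(1) l(1) gap] compact_space_blow_up[OF z(1) l(1) gap]
    by blast
qed

end
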